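(* Let $\mathcal{P}\subset\mathbb{R}^K$ be a compact, convex, full-dimensional set, and let $\mathcal{K}=\mathrm{cone}\left(\{[\bm x;1]:\bm x\in\mathcal{P}\}\right)\subseteq\mathbb{R}^{K+1}$. Let $\bm A\in\mathbb{S}^K_{++}$ and $\bm b\in\mathbb{R}^K$. Then the ellipsoid $\mathcal{E}(\bm A,\bm b)=\{\bm x\in\mathbb{R}^K:\|\bm A\bm x+\bm b\|^2\le 1\}$ contains $\mathcal{P}$ if and only if there exist $\bm F\in\mathbb{S}^K$, $\bm g\in\mathbb{R}^K$, $h\in\mathbb{R}$ such that $$\begin{bmatrix}\bm F&\bm g\\ \bm g^\top&h-1\end{bmatrix}\preceq_{\mathcal{C}(\mathcal{K})}\bm 0\quad\text{and}\quad\begin{bmatrix}\bm F&\bm g&\bm A\\ \bm g^\top&h&\bm b^\top\\ \bm A&\bm b&\mathbb{I}\end{bmatrix}\succeq\bm 0.$$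
   Context: $\mathbb{S}^K$, $\mathbb{S}^K_+$, $\mathbb{S}^K_{++}$ are the sets of real symmetric, symmetric positive semidefinite, and symmetric positive definite $K\times K$ matrices; $\mathbb{I}$ is the identity matrix; $\|\cdot\|$ is the Euclidean norm. $[\bm u;\bm v]$ denotes vertical concatenation. $\mathrm{cone}(S)$ is the conic hull of $S$ (all finite nonnegative combinations of elements of $S$). Full-dimensional means having nonempty interior. For a cone $\mathcal{K}\subseteq\mathbb{R}^{n}$, the set of generalized copositive matrices is $\mathcal{C}(\mathcal{K})=\{\bm M\in\mathbb{S}^{n}:\bm x^\top\bm M\bm x\ge 0\ \forall\bm x\in\mathcal{K}\}$. For symmetric matrices, $\bm P\succeq_{\mathcal{C}(\mathcal{K})}\bm Q$ (equivalently $\bm Q\preceq_{\mathcal{C}(\mathcal{K})}\bm P$) means $\bm P-\bm Q\in\mathcal{C}(\mathcal{K})$; $\bm P\succeq\bm Q$ means $\bm P-\bm Q$ is symmetric positive semidefinite. *)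

theory Defs
  imports "HOL-Analysis.Analysis"
begin

definition sym_mats :: "(real^'n^'n) set" where
  "sym_mats = {M. transpose M = M}"

definition psd_mats :: "(real^'n^'n) set" where
  "psd_mats = {M \<in> sym_mats. \<forall>x. 0 \<le> x \<bullet> (M *v x)}"

definition pd_mats :: "(real^'n^'n) set" where
  "pd_mats = {M \<in> sym_mats. \<forall>x. x \<noteq> 0 \<longrightarrow> 0 < x \<bullet> (M *v x)}"

definition loewner_ge :: "real^'n^'n \<Rightarrow> real^'n^'n \<Rightarrow> bool" where
  "loewner_ge P Q \<longleftrightarrow> P - Q \<in> psd_mats"

definition copositive_mats :: "(real^'n) set \<Rightarrow> (real^'n^'n) set" where
  "copositive_mats K = {M \<in> sym_mats. \<forall>x\<in>K. 0 \<le> x \<bullet> (M *v x)}"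

definition copositive_le :: "(real^'n) set \<Rightarrow> real^'n^'n \<Rightarrow> real^'n^'n \<Rightarrow> bool" where
  "copositive_le K Q P \<longleftrightarrow> P - Q \<in> copositive_mats K"

text \<open>The library's \<open>cone hull\<close> and \<open>conic hull\<close> close a set under nonnegative scaling only,
  not under sums. The set of all finite nonnegative combinations is the library's
  \<open>convex_cone hull\<close>.\<close>

definition cone_gen :: "'a::real_vector set \<Rightarrow> 'a set" where
  "cone_gen S = {\<Sum>v\<in>T. c v *\<^sub>R v | T c. finite T \<and> T \<subseteq> S \<and> (\<forall>v\<in>T. 0 \<le> c v)}"

lemma cone_gen_eq_convex_cone_hull: "cone_gen S = convex_cone hull S"
proof
  show "cone_gen S \<subseteq> convex_cone hull S"
  proof
    fix x assume "x \<in> cone_gen S"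
    then obtain T c where T: "finite T" "T \<subseteq> S" "\<forall>v\<in>T. 0 \<le> c v"
      and x: "x = (\<Sum>v\<in>T. c v *\<^sub>R v)"
      by (auto simp: cone_gen_def)
    have "(\<Sum>v\<in>T. c v *\<^sub>R v) \<in> convex_cone hull S"
      using T
    proof (induction T rule: finite_induct)
      case empty
      show ?case by (simp add: convex_cone_hull_contains_0)
    next
      case (insert a T)
      then have "c a *\<^sub>R a \<in> convex_cone hull S"
        by (intro convex_cone_hull_mul hull_inc) auto
      with insert show ?case by (auto intro: convex_cone_hull_add)
    qed
    then show "x \<in> convex_cone hull S" using x by simp
  qed
  have add: "x + y \<in> cone_gen S" if xy: "x \<in> cone_gen S" "y \<in> cone_gen S" for x y
  proof -
    obtain T c where T: "finite T" "T \<subseteq> S" "\<forall>v\<in>T. 0 \<le> c v" "x = (\<Sum>v\<in>T. c v *\<^sub>R v)"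
      using xy(1) by (auto simp: cone_gen_def)
    obtain U d where U: "finite U" "U \<subseteq> S" "\<forall>v\<in>U. 0 \<le> d v" "y = (\<Sum>v\<in>U. d v *\<^sub>R v)"
      using xy(2) by (auto simp: cone_gen_def)
    let ?e = "\<lambda>v. (if v \<in> T then c v else 0) + (if v \<in> U then d v else 0)"
    have "x = (\<Sum>v\<in>T \<union> U. (if v \<in> T then c v else 0) *\<^sub>R v)"
      unfolding T(4) by (rule sum.mono_neutral_cong_left) (use T U in auto)
    moreover have "y = (\<Sum>v\<in>T \<union> U. (if v \<in> U then d v else 0) *\<^sub>R v)"
      unfolding U(4) by (rule sum.mono_neutral_cong_left) (use T U in auto)
    ultimately have "x + y = (\<Sum>v\<in>T \<union> U. ?e v *\<^sub>R v)"
      by (simp only: scaleR_add_left sum.distrib)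
    moreover have "finite (T \<union> U)" "T \<union> U \<subseteq> S" "\<forall>v\<in>T \<union> U. 0 \<le> ?e v"
      using T U by auto
    ultimately show ?thesis
      unfolding cone_gen_def by (intro CollectI exI[of _ "T \<union> U"] exI[of _ ?e]) simp
  qed
  have scale: "r *\<^sub>R x \<in> cone_gen S" if x: "x \<in> cone_gen S" and r: "0 \<le> r" for x r
  proof -
    obtain T c where T: "finite T" "T \<subseteq> S" "\<forall>v\<in>T. 0 \<le> c v" "x = (\<Sum>v\<in>T. c v *\<^sub>R v)"
      using x by (auto simp: cone_gen_def)
    then show ?thesis
      unfolding cone_gen_def using r
      by (intro CollectI exI[of _ T] exI[of _ "\<lambda>v. r * c v"]) (simp add: scaleR_sum_right)
  qed
  have inc: "S \<subseteq> cone_gen S"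
  proof
    fix x assume "x \<in> S"
    then show "x \<in> cone_gen S"
      unfolding cone_gen_def by (intro CollectI exI[of _ "{x}"] exI[of _ "\<lambda>_. 1"]) simp
  qed
  have "0 \<in> cone_gen S"
    unfolding cone_gen_def by (intro CollectI exI[of _ "{}"]) simp
  then have "convex_cone (cone_gen S)"
    by (auto simp: convex_cone_def convex_def conic_def intro!: add scale)
  with inc show "convex_cone hull S \<subseteq> cone_gen S" by (rule hull_minimal)
qed

text \<open>Vertical concatenation, indexed by the sum of the index types. Since a matrix is the vector
  of its rows, \<open>vcat\<close> also stacks matrices with equally many columns.\<close>

definition vcat :: "'a^'m \<Rightarrow> 'a^'n \<Rightarrow> 'a^('m + 'n)" where
  "vcat u v = (\<chi> i. case i of Inl j \<Rightarrow> u $ j | Inr j \<Rightarrow> v $ j)"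

definition hcat :: "'a^'m^'r \<Rightarrow> 'a^'n^'r \<Rightarrow> 'a^('m + 'n)^'r" where
  "hcat M N = (\<chi> i. vcat (M $ i) (N $ i))"

definition block_mat ::
    "'a^'m^'r \<Rightarrow> 'a^'n^'r \<Rightarrow> 'a^'m^'s \<Rightarrow> 'a^'n^'s \<Rightarrow> 'a^('m + 'n)^('r + 's)" where
  "block_mat M11 M12 M21 M22 = vcat (hcat M11 M12) (hcat M21 M22)"

definition ellipsoid :: "real^'k^'k \<Rightarrow> real^'k \<Rightarrow> (real^'k) set" where
  "ellipsoid A b = {x. (norm (A *v x + b))\<^sup>2 \<le> 1}"

text \<open>The set \<open>{[x; 1] : x \<in> P}\<close>; the appended coordinate has the one-element index type \<open>1\<close>.\<close>

definition lift_set :: "(real^'k) set \<Rightarrow> (real^('k + 1)) set" where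
  "lift_set P = {vcat x (vec 1) | x. x \<in> P}"

text \<open>A column vector, a row vector and a scalar become matrix blocks through the library's
  \<open>columnvector\<close>, \<open>rowvector\<close> and \<open>mat\<close>, at index type \<open>1\<close>.\<close>

definition bordered_mat :: "real^'k^'k \<Rightarrow> real^'k \<Rightarrow> real \<Rightarrow> real^('k + 1)^('k + 1)" where
  "bordered_mat F g h = block_mat F (columnvector g) (rowvector g) (mat h)"

text \<open>The three-by-three block matrix with block rows \<open>[F, g, A]\<close>, \<open>[g\<^sup>T, h, b\<^sup>T]\<close> and
  \<open>[A, b, I]\<close>.\<close>

definition schur_mat ::
    "real^'k^'k \<Rightarrow> real^'k \<Rightarrow> real \<Rightarrow> real^'k^'k \<Rightarrow> real^'k
      \<Rightarrow> real^(('k + 1) + 'k)^(('k + 1) + 'k)" where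
  "schur_mat F g h A b =
     block_mat (bordered_mat F g h) (vcat A (rowvector b))
               (hcat A (columnvector b)) (mat 1)"

end

(* The Schur complement of the identity block in the 3x3 matrix is nonnegative iff the quadratic form
   of [F, g; g^T, h] dominates |A x + t b|^2. On the slice t = 1 over P, copositivity bounds that form
   by 1, so P lies in the ellipsoid. Conversely F = A A, g = A b, h = |b|^2 makes the two forms equal,
   and |A x + t b| <= t propagates from the generators [x; 1] to the whole cone. *)
theory Submission
  imports Defs
begin

text \<open>An index sum over a sum type splits at the block boundary; inner products and
  matrix-vector products of block objects become blockwise through this.\<close>

lemma sum_UNIV_Plus:
  fixes f :: "'m::finite + 'n::finite \<Rightarrow> 'a::comm_monoid_add"
  shows "(\<Sum>i\<in>UNIV. f i) = (\<Sum>i\<in>UNIV. f (Inl i)) + (\<Sum>i\<in>UNIV. f (Inr i))"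
  by (simp add: UNIV_Plus_UNIV[symmetric] sum.Plus comp_def del: UNIV_Plus_UNIV)

lemma vcat_nth [simp]: "vcat u v $ Inl i = u $ i" "vcat u v $ Inr j = v $ j"
  by (simp_all add: vcat_def)

text \<open>Together with \<open>vec_one_cases\<close>, lets a form computed only on explicit
  concatenations \<open>[[x; t]; z]\<close> be applied to arbitrary vectors.\<close>

lemma vcat_cases:
  obtains u v where "w = vcat u v"
proof
  show "w = vcat (\<chi> i. w $ Inl i) (\<chi> j. w $ Inr j)"
    by (simp add: vec_eq_iff vcat_def split: sum.split)
qed

lemma vec_one_cases:
  fixes v :: "'a^1"
  obtains t where "v = vec t"
  by (metis (full_types) vec_eq_iff vec_component num1_eq1)

lemma vcat_add: "vcat u v + vcat u' v' = vcat (u + u') (v + v')"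
  by (simp add: vec_eq_iff vcat_def split: sum.split)

lemma vcat_scaleR: "c *\<^sub>R vcat u v = vcat (c *\<^sub>R u) (c *\<^sub>R v)"
  by (simp add: vec_eq_iff vcat_def split: sum.split)

lemma inner_vcat: "vcat u v \<bullet> vcat u' v' = u \<bullet> u' + v \<bullet> v'"
  by (simp add: inner_vec_def sum_UNIV_Plus)

lemma vcat_mult_vec: "vcat M N *v x = vcat (M *v x) (N *v x)"
  by (simp add: vec_eq_iff matrix_vector_mult_def vcat_def split: sum.split)

lemma hcat_mult_vcat: "hcat M N *v vcat u v = M *v u + N *v v"
  by (simp add: vec_eq_iff matrix_vector_mult_def hcat_def sum_UNIV_Plus)

lemma block_mat_mult_vcat:
  "block_mat M11 M12 M21 M22 *v vcat u v = vcat (M11 *v u + M12 *v v) (M21 *v u + M22 *v v)"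
  by (simp add: block_mat_def vcat_mult_vec hcat_mult_vcat)

lemma transpose_vcat: "transpose (vcat M N) = hcat (transpose M) (transpose N)"
  by (simp add: vec_eq_iff transpose_def hcat_def vcat_def split: sum.split)

lemma transpose_hcat: "transpose (hcat M N) = vcat (transpose M) (transpose N)"
  by (simp add: vec_eq_iff transpose_def hcat_def vcat_def split: sum.split)

lemma transpose_block_mat:
  "transpose (block_mat M11 M12 M21 M22)
    = block_mat (transpose M11) (transpose M21) (transpose M12) (transpose M22)"
  by (simp add: vec_eq_iff transpose_def block_mat_def hcat_def vcat_def split: sum.split)

lemma columnvector_mult_vec: "columnvector (g :: real^'n) *v (vec t :: real^1) = t *\<^sub>R g"
  by (simp add: vec_eq_iff matrix_vector_mult_def columnvector_def)

lemma rowvector_mult: "rowvector (g :: real^'n) *v x = vec (g \<bullet> x)"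
  by (simp add: vec_eq_iff matrix_vector_mult_def rowvector_def inner_vec_def)

lemma mat_one_mult_vec: "(mat h :: real^1^1) *v vec t = vec (h * t)"
  by (simp add: vec_eq_iff matrix_vector_mult_def mat_def)

lemma inner_vec_one: "(vec s :: real^1) \<bullet> vec t = s * t"
  by (simp add: inner_vec_def)

lemma bordered_mat_sym: "F \<in> sym_mats \<Longrightarrow> bordered_mat F g h \<in> sym_mats"
  by (simp add: sym_mats_def bordered_mat_def transpose_block_mat transpose_columnvector
      transpose_rowvector)

text \<open>The last block row and the last block column both carry \<open>A\<close> itself, so they
  are transposes of each other by symmetry of \<open>A\<close>.\<close>

lemma schur_mat_sym:
  assumes "F \<in> sym_mats" "A \<in> sym_mats"
  shows "schur_mat F g h A b \<in> sym_mats"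
  using assms bordered_mat_sym[of F g h]
  by (simp add: sym_mats_def schur_mat_def transpose_block_mat transpose_vcat transpose_hcat
      transpose_columnvector transpose_rowvector)

lemma sym_mats_uminus: "M \<in> sym_mats \<Longrightarrow> - M \<in> sym_mats"
  by (simp add: sym_mats_def vec_eq_iff transpose_def)

lemma uminus_matrix_mult_vec: "(- M) *v (x :: real^'n) = - (M *v x)"
  by (simp add: vec_eq_iff matrix_vector_mult_def sum_negf)

lemma sym_mats_inner: "A \<in> sym_mats \<Longrightarrow> x \<bullet> (A *v y) = (A *v x) \<bullet> y"
  by (metis (mono_tags) sym_mats_def mem_Collect_eq dot_lmul_matrix transpose_matrix_vector)

text \<open>The height \<open>t\<close> stays general because the cone contains points of every
  nonnegative multiple of a generator. The corner enters only through \<open>h * t\<^sup>2\<close>,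
  so passing from \<open>h\<close> to \<open>h - 1\<close> subtracts
  \<open>t\<^sup>2\<close>.\<close>

lemma bordered_mat_form:
  fixes x :: "real^'k"
  shows "vcat x (vec t) \<bullet> (bordered_mat F g h *v vcat x (vec t))
    = x \<bullet> (F *v x) + 2 * t * (g \<bullet> x) + h * t\<^sup>2"
  by (simp add: bordered_mat_def block_mat_mult_vcat inner_vcat columnvector_mult_vec
      rowvector_mult mat_one_mult_vec inner_vec_one vec_add inner_commute power2_eq_square
      algebra_simps)

text \<open>Symmetry of \<open>A\<close> merges the two cross terms in \<open>x\<close> and
  \<open>z\<close>. With \<open>y = A *v x + t *\<^sub>R b\<close>, the part involving
  \<open>z\<close> is |z + y|^2 - |y|^2, so the minimum over \<open>z\<close> is the bordered form
  minus |y|^2, the form of the Schur complement.\<close>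

lemma schur_mat_form:
  fixes x z :: "real^'k"
  assumes "A \<in> sym_mats"
  shows "vcat (vcat x (vec t)) z \<bullet> (schur_mat F g h A b *v vcat (vcat x (vec t)) z)
    = vcat x (vec t) \<bullet> (bordered_mat F g h *v vcat x (vec t))
      + 2 * (z \<bullet> (A *v x + t *\<^sub>R b)) + z \<bullet> z"
proof -
  have "x \<bullet> (A *v z) = z \<bullet> (A *v x)"
    by (simp add: sym_mats_inner[OF assms, of x z] inner_commute)
  then show ?thesis
    by (simp add: schur_mat_def block_mat_mult_vcat inner_vcat vcat_mult_vec hcat_mult_vcat
        columnvector_mult_vec rowvector_mult inner_vec_one inner_commute algebra_simps)
qed

text \<open>Expanding the squared norm gives the coefficients \<open>A ** A\<close>,
  \<open>A *v b\<close> and \<open>b \<bullet> b\<close>. The corner is left free to serve two uses: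
  \<open>b \<bullet> b\<close> in the semidefinite matrix (correction 0) and
  \<open>b \<bullet> b - 1\<close> in the copositive one (correction -t^2).\<close>

lemma norm_affine_form:
  fixes x :: "real^'k"
  assumes "A \<in> sym_mats"
  shows "vcat x (vec t) \<bullet> (bordered_mat (A ** A) (A *v b) h *v vcat x (vec t))
    = (norm (A *v x + t *\<^sub>R b))\<^sup>2 + (h - b \<bullet> b) * t\<^sup>2"
proof -
  have "x \<bullet> ((A ** A) *v x) = (A *v x) \<bullet> (A *v x)"
    by (simp add: matrix_vector_mul_assoc[symmetric] sym_mats_inner[OF assms])
  moreover have "(A *v b) \<bullet> x = (A *v x) \<bullet> b"
    by (metis sym_mats_inner[OF assms] inner_commute)
  ultimately show ?thesis
    unfolding bordered_mat_form power2_norm_eq_inner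
    by (simp add: inner_commute power2_eq_square algebra_simps)
qed

text \<open>The inequality describes the preimage of a second-order cone under a linear map. This is
  a convex cone containing the generators, hence also their convex cone hull.\<close>

lemma norm_le_height_on_cone:
  fixes P :: "(real^'k) set"
  assumes "P \<subseteq> ellipsoid A b" and "v \<in> cone_gen (lift_set P)"
  obtains x t where "v = vcat x (vec t)" "norm (A *v x + t *\<^sub>R b) \<le> t"
proof -
  \<comment> \<open>The norm is not squared here: the squared inequality would also admit negative
    \<open>t\<close>, giving a double cone that is in general not closed under sums.\<close>
  define C :: "(real^('k + 1)) set"
    where "C = {vcat x (vec t) | x t. norm (A *v x + t *\<^sub>R b) \<le> t}"
  have zero: "0 \<in> C"
    unfolding C_def by (intro CollectI exI[of _ 0]) (simp add: vec_eq_iff vcat_def split: sum.split)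
  have scale: "c *\<^sub>R w \<in> C" if wC: "w \<in> C" and c: "0 \<le> c" for w c
  proof -
    obtain x t where w: "w = vcat x (vec t)" and le: "norm (A *v x + t *\<^sub>R b) \<le> t"
      using wC unfolding C_def by blast
    have "norm (A *v (c *\<^sub>R x) + (c * t) *\<^sub>R b) = norm (c *\<^sub>R (A *v x + t *\<^sub>R b))"
      by (simp add: matrix_vector_mult_scaleR scaleR_add_right)
    also have "\<dots> \<le> c * t" using le c by (simp add: mult_left_mono)
    finally have "norm (A *v (c *\<^sub>R x) + (c * t) *\<^sub>R b) \<le> c * t" .
    moreover have "c *\<^sub>R w = vcat (c *\<^sub>R x) (vec (c * t))"
      by (simp add: w vcat_scaleR vec_eq_iff vcat_def split: sum.split)
    ultimately show ?thesis unfolding C_def by blast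
  qed
  have add: "w + w' \<in> C" if wC: "w \<in> C" and w'C: "w' \<in> C" for w w'
  proof -
    obtain x t where w: "w = vcat x (vec t)" and le: "norm (A *v x + t *\<^sub>R b) \<le> t"
      using wC unfolding C_def by blast
    obtain x' t' where w': "w' = vcat x' (vec t')" and le': "norm (A *v x' + t' *\<^sub>R b) \<le> t'"
      using w'C unfolding C_def by blast
    have "A *v (x + x') + (t + t') *\<^sub>R b = (A *v x + t *\<^sub>R b) + (A *v x' + t' *\<^sub>R b)"
      by (simp add: matrix_vector_right_distrib scaleR_add_left)
    then have "norm (A *v (x + x') + (t + t') *\<^sub>R b) \<le> t + t'"
      using norm_triangle_mono[OF le le'] by simp
    moreover have "w + w' = vcat (x + x') (vec (t + t'))"
      by (simp add: w w' vcat_add vec_add)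
    ultimately show ?thesis unfolding C_def by blast
  qed
  have "convex_cone C"
    using zero by (auto simp: convex_cone_def convex_def conic_def intro!: add scale)
  moreover have "lift_set P \<subseteq> C"
  proof
    fix w assume "w \<in> lift_set P"
    then obtain x where w: "w = vcat x (vec 1)" and "x \<in> P" by (auto simp: lift_set_def)
    with assms(1) have "norm (A *v x + b) \<le> 1"
      by (auto simp: ellipsoid_def power_le_one_iff)
    with w show "w \<in> C" unfolding C_def by (intro CollectI exI[of _ x] exI[of _ 1]) simp
  qed
  ultimately have "cone_gen (lift_set P) \<subseteq> C"
    unfolding cone_gen_eq_convex_cone_hull by (intro hull_minimal)
  with assms(2) have "v \<in> C" by blast
  then show thesis using that unfolding C_def by blast
qed

theorem theorem1:
  fixes P :: "(real^'k) set" and K :: "(real^('k + 1)) set"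
    and A :: "real^'k^'k" and b :: "real^'k"
  assumes "compact P" and "convex P" and "interior P \<noteq> {}"
    and "K = cone_gen (lift_set P)"
    and "A \<in> pd_mats"
  shows "P \<subseteq> ellipsoid A b \<longleftrightarrow>
    (\<exists>F \<in> sym_mats. \<exists>(g :: real^'k) (h :: real).
       copositive_le K (bordered_mat F g (h - 1)) 0 \<and>
       loewner_ge (schur_mat F g h A b) 0)"
proof
  have A: "A \<in> sym_mats" using assms(5) by (simp add: pd_mats_def)
  {
    assume P: "P \<subseteq> ellipsoid A b"
    let ?g = "A *v b" and ?h = "b \<bullet> b"
    have AA: "A ** A \<in> sym_mats"
      using A by (simp add: sym_mats_def matrix_transpose_mul)
    have "0 \<le> v \<bullet> (- bordered_mat (A ** A) ?g (?h - 1) *v v)" if v: "v \<in> K" for v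
    proof -
      obtain x t where "v = vcat x (vec t)" "norm (A *v x + t *\<^sub>R b) \<le> t"
        using norm_le_height_on_cone[OF P] v assms(4) by blast
      \<comment> \<open>With corner \<open>?h - 1\<close> the bordered form is the left side minus
        the right side, so its negative is nonnegative exactly when this holds.\<close>
      moreover from this(2) have "(norm (A *v x + t *\<^sub>R b))\<^sup>2 \<le> t\<^sup>2"
        by (intro power_mono) auto
      ultimately show ?thesis
        by (simp add: uminus_matrix_mult_vec norm_affine_form[OF A])
    qed
    then have "copositive_le K (bordered_mat (A ** A) ?g (?h - 1)) 0"
      by (simp add: copositive_le_def copositive_mats_def sym_mats_uminus bordered_mat_sym AA)
    moreover have "0 \<le> w \<bullet> (schur_mat (A ** A) ?g ?h A b *v w)" for w
    proof -
      obtain v z where w: "w = vcat v z" by (rule vcat_cases)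
      obtain x s where v: "v = vcat x s" by (rule vcat_cases)
      obtain t where s: "s = vec t" by (rule vec_one_cases)
      \<comment> \<open>For these witnesses the bordered form is itself |A x + t b|^2, so adding the
        terms in \<open>z\<close> completes the square with no remainder.\<close>
      have "w \<bullet> (schur_mat (A ** A) ?g ?h A b *v w) = (norm (A *v x + t *\<^sub>R b + z))\<^sup>2"
        unfolding w v s schur_mat_form[OF A] norm_affine_form[OF A] power2_norm_eq_inner
        by (simp add: inner_add_left inner_add_right inner_commute)
      then show ?thesis by simp
    qed
    then have "loewner_ge (schur_mat (A ** A) ?g ?h A b) 0"
      by (simp add: loewner_ge_def psd_mats_def schur_mat_sym AA A)
    ultimately show "\<exists>F \<in> sym_mats. \<exists>g h. copositive_le K (bordered_mat F g (h - 1)) 0 \<and>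
       loewner_ge (schur_mat F g h A b) 0"
      using AA by blast
  next
    assume "\<exists>F \<in> sym_mats. \<exists>g h. copositive_le K (bordered_mat F g (h - 1)) 0 \<and>
       loewner_ge (schur_mat F g h A b) 0"
    then obtain F g h where cop: "copositive_le K (bordered_mat F g (h - 1)) 0"
      and psd: "loewner_ge (schur_mat F g h A b) 0" by blast
    show "P \<subseteq> ellipsoid A b"
    proof
      fix x assume x: "x \<in> P"
      let ?v = "vcat x (vec 1) :: real^('k + 1)" and ?y = "A *v x + b"
      have "?v \<in> K"
        unfolding assms(4) cone_gen_eq_convex_cone_hull
        by (rule hull_inc) (use x in \<open>auto simp: lift_set_def\<close>)
      with cop have "?v \<bullet> (bordered_mat F g (h - 1) *v ?v) \<le> 0"
        by (auto simp: copositive_le_def copositive_mats_def uminus_matrix_mult_vec)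
      \<comment> \<open>At height 1, restoring the corner from \<open>h - 1\<close> to
        \<open>h\<close> raises the form by exactly 1.\<close>
      then have "?v \<bullet> (bordered_mat F g h *v ?v) \<le> 1"
        unfolding bordered_mat_form by (simp add: algebra_simps)
      moreover have "0 \<le> vcat ?v (- ?y) \<bullet> (schur_mat F g h A b *v vcat ?v (- ?y))"
        using psd by (simp add: loewner_ge_def psd_mats_def del: minus_add_distrib)
      \<comment> \<open>\<open>- ?y\<close> minimises the form over the last block\<close>
      then have "(norm ?y)\<^sup>2 \<le> ?v \<bullet> (bordered_mat F g h *v ?v)"
        unfolding schur_mat_form[OF A] power2_norm_eq_inner
        by (simp del: minus_add_distrib)
      ultimately show "x \<in> ellipsoid A b" by (simp add: ellipsoid_def)
    qed
  }
qed

end
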